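(* For each $n\ge1$ there is an ideal $I$ on a countably infinite set $X$ such that $\mathcal C_I$ is precomplete via one $(n+1)$-ary function but not via (even infinitely many) $n$-ary functions; that is, $\mathcal C_I$ is precomplete, $T(A,n+1,1)$ holds for all subsets $A\subseteq X$ with $A\notin I$, and there is a subset $A\subseteq X$ with $A\notin I$ such that $T(A,n,\infty)$ fails.
   Context: Let $\mathcal O^{(n)}$ be the set of all functions $X^n\to X$ ($n\ge 1$) and $\mathcal O=\bigcup_{n\ge1}\mathcal O^{(n)}$. A clone on $X$ is a subset of $\mathcal O$ that contains all projections and is closed under composition. A clone $\mathcal C\neq\mathcal O$ is precomplete if there is no clone strictly between $\mathcal C$ and $\mathcal O$. An ideal on $X$ means here a family $I$ of subsets of $X$ that is closed under subsets and finite unions, contains all finite subsets of $X$, contains at least one infinite set, and does not contain all subsets of $X$. For an ideal $I$, $\mathcal C_I=\bigcup_{n\ge1}\{f\in\mathcal O^{(n)}: f[A^n]\in I\text{ for all }A\in I\}$. For $A\subseteq X$, $n\ge1$ and $p\in\{1,2,\dots\}\cup\{\infty\}$, $T(A,n,p)$ (relative to $I$) means: there is a sequence $(f_k)_{k=1}^p$ of $n$-ary functions on $X$ (an infinite sequence indexed by $k=1,2,\dots$ if $p=\infty$) such that (i) $\bigcup_{k=1}^p f_k[A^n]=X$ and (ii) $\bigcup_{k=1}^p f_k[B^n]\in I$ for all $B\in I$. One says that $\mathcal C_I$ is precomplete via $p$ $n$-ary functions if $T(A,n,p)$ holds for all $A\notin I$. *)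

theory Defs
  imports "HOL-Library.NList" "HOL-Library.FuncSet" "HOL-Library.Extended_Nat"
    "HOL-Library.Countable_Set"
begin

(* X^n is the library set nlists n X of lists of length n with entries in X.  An n-ary
   function on X is extensional, so that equality of HOL functions is equality on X^n. *)
definition nary_ops :: "'a set \<Rightarrow> nat \<Rightarrow> ('a list \<Rightarrow> 'a) set" where
  "nary_ops X n = nlists n X \<rightarrow>\<^sub>E X"

(* Elements carry their arity: extensional functions of different arities may coincide
   as HOL functions (e.g. those with constant value undefined, if that lies in X). *)
definition all_ops :: "'a set \<Rightarrow> (nat \<times> ('a list \<Rightarrow> 'a)) set" where
  "all_ops X = (SIGMA n:{1..}. nary_ops X n)"

definition projection :: "'a set \<Rightarrow> nat \<Rightarrow> nat \<Rightarrow> 'a list \<Rightarrow> 'a" where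
  "projection X n i = (\<lambda>xs\<in>nlists n X. xs ! i)"

(* f(g_1, ..., g_m) for m-ary f, a list gs of m functions, and common arity k of the g_i *)
definition compose_ops :: "'a set \<Rightarrow> nat \<Rightarrow> ('a list \<Rightarrow> 'a) \<Rightarrow> ('a list \<Rightarrow> 'a) list \<Rightarrow> 'a list \<Rightarrow> 'a" where
  "compose_ops X k f gs = (\<lambda>xs\<in>nlists k X. f (map (\<lambda>g. g xs) gs))"

definition is_clone :: "'a set \<Rightarrow> (nat \<times> ('a list \<Rightarrow> 'a)) set \<Rightarrow> bool" where
  "is_clone X C \<longleftrightarrow>
     C \<subseteq> all_ops X \<and>
     (\<forall>n\<ge>1. \<forall>i<n. (n, projection X n i) \<in> C) \<and>
     (\<forall>m f k gs. (m, f) \<in> C \<and> k \<ge> 1 \<and> length gs = m \<and> (\<forall>g\<in>set gs. (k, g) \<in> C)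
        \<longrightarrow> (k, compose_ops X k f gs) \<in> C)"

definition precomplete :: "'a set \<Rightarrow> (nat \<times> ('a list \<Rightarrow> 'a)) set \<Rightarrow> bool" where
  "precomplete X C \<longleftrightarrow>
     is_clone X C \<and> C \<noteq> all_ops X \<and>
     \<not> (\<exists>D. is_clone X D \<and> C \<subset> D \<and> D \<subset> all_ops X)"

definition is_ideal :: "'a set \<Rightarrow> 'a set set \<Rightarrow> bool" where
  "is_ideal X I \<longleftrightarrow>
     I \<subseteq> Pow X \<and>
     (\<forall>A\<in>I. \<forall>B. B \<subseteq> A \<longrightarrow> B \<in> I) \<and>
     (\<forall>A\<in>I. \<forall>B\<in>I. A \<union> B \<in> I) \<and>
     (\<forall>A. A \<subseteq> X \<and> finite A \<longrightarrow> A \<in> I) \<and>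
     (\<exists>A\<in>I. infinite A) \<and>
     I \<noteq> Pow X"

definition ideal_clone :: "'a set \<Rightarrow> 'a set set \<Rightarrow> (nat \<times> ('a list \<Rightarrow> 'a)) set" where
  "ideal_clone X I = {(n, f) \<in> all_ops X. \<forall>A\<in>I. f ` nlists n A \<in> I}"

(* T(A,n,p) relative to I; the length p of the sequence is a positive integer or infinity. *)
definition T_prop :: "'a set \<Rightarrow> 'a set set \<Rightarrow> 'a set \<Rightarrow> nat \<Rightarrow> enat \<Rightarrow> bool" where
  "T_prop X I A n p \<longleftrightarrow>
     (\<exists>f :: nat \<Rightarrow> 'a list \<Rightarrow> 'a.
        (\<forall>k\<in>{k. 1 \<le> k \<and> enat k \<le> p}. f k \<in> nary_ops X n) \<and>
        (\<Union>k\<in>{k. 1 \<le> k \<and> enat k \<le> p}. f k ` nlists n A) = X \<and>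
        (\<forall>B\<in>I. (\<Union>k\<in>{k. 1 \<le> k \<and> enat k \<le> p}. f k ` nlists n B) \<in> I))"

definition precomplete_via :: "'a set \<Rightarrow> 'a set set \<Rightarrow> enat \<Rightarrow> nat \<Rightarrow> bool" where
  "precomplete_via X I p n \<longleftrightarrow> (\<forall>A. A \<subseteq> X \<and> A \<notin> I \<longrightarrow> T_prop X I A n p)"

end

theory Submission
  imports Defs
begin

text \<open>
  Let \<open>J\<close> be a maximal ideal on the natural numbers containing all finite sets, and let
  \<open>X\<close> be the set of \<open>n+1\<close>-tuples of natural numbers, coded by numbers. The ideal \<open>I\<close> consists
  of the sets all of whose \<open>n+1\<close> coordinate projections lie in \<open>J\<close>; it is generated by the
  cubes \<open>B\<^sup>n\<^sup>+\<^sup>1\<close> with \<open>B\<close> in \<open>J\<close>.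

  One \<open>(n+1)\<close>-ary function suffices: a set outside \<open>I\<close> has a projection outside \<open>J\<close>, by
  maximality of \<open>J\<close> this projection is mapped onto all numbers by a unary function that
  preserves \<open>J\<close> (\<open>unary_onto\<close>), and \<open>n+1\<close> numbers obtained in this way from \<open>n+1\<close> points can be
  put together to form any tuple.

  Countably many \<open>n\<close>-ary functions do not suffice on the diagonal, which is a copy of the numbers.
  Given such functions, let \<open>S ys\<close> be the set of all coordinates of all values at the
  diagonal points given by \<open>ys\<close>. The key fact (\<open>few_outputs_off_inputs\<close>) is that, because \<open>S\<close>
  maps \<open>J\<close> to \<open>J\<close>, the numbers \<open>z\<close> outside a set in \<open>J\<close> are members of \<open>S ys\<close> only if
  \<open>z\<close> is an entry of \<open>ys\<close>. This rests on Katetov's observation that an ultrafilter is moved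
  away from itself by a function without fixed points (\<open>moves_off\<close>), proved by colouring the
  graph of the function. So a tuple of \<open>n+1\<close> distinct numbers outside that set would
  have to be a value at arguments with only \<open>n\<close> entries.

  Precompleteness itself follows from the surjections: if a clone contains the clone of \<open>I\<close> and
  an operation \<open>g\<close> mapping a small set \<open>B\<close> to a large set, then composing \<open>g\<close> with a
  surjection for that large set produces every element from arguments in \<open>B\<close>, and operations
  with values in \<open>B\<close> preserve \<open>I\<close>.
\<close>

section \<open>Surjections from large sets make an ideal clone precomplete\<close>

lemma is_ideal_subset: "is_ideal X I \<Longrightarrow> A \<in> I \<Longrightarrow> B \<subseteq> A \<Longrightarrow> B \<in> I"
  by (simp add: is_ideal_def)

lemma is_ideal_carrier: "is_ideal X I \<Longrightarrow> A \<in> I \<Longrightarrow> A \<subseteq> X"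
  by (auto simp: is_ideal_def)

lemma is_ideal_Un: "is_ideal X I \<Longrightarrow> A \<in> I \<Longrightarrow> B \<in> I \<Longrightarrow> A \<union> B \<in> I"
  by (simp add: is_ideal_def)

lemma is_ideal_UNION:
  assumes "is_ideal X I" "finite K" "\<And>k. k \<in> K \<Longrightarrow> A k \<in> I"
  shows "(\<Union>k\<in>K. A k) \<in> I"
  using assms(2,3)
proof (induction K rule: finite_induct)
  case empty
  then show ?case using assms(1) unfolding is_ideal_def by simp
next
  case (insert k K)
  then have "A k \<union> (\<Union>k\<in>K. A k) \<in> I"
    by (intro is_ideal_Un[OF assms(1)]) auto
  then show ?case by simp
qed

lemma is_clone_ideal_clone:
  assumes I: "is_ideal X I"
  shows "is_clone X (ideal_clone X I)"
  unfolding is_clone_def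
proof (intro conjI allI impI)
  show "ideal_clone X I \<subseteq> all_ops X"
    by (auto simp: ideal_clone_def)
next
  fix n i :: nat assume "1 \<le> n" "i < n"
  moreover have "projection X n i ` nlists n A \<subseteq> A" if "A \<in> I" for A
  proof -
    have "nlists n A \<subseteq> nlists n X"
      using is_ideal_carrier[OF I that] by (rule nlists_mono)
    then show ?thesis
      using \<open>i < n\<close> by (auto simp: projection_def subset_eq intro: nlistsE_nth_in)
  qed
  ultimately show "(n, projection X n i) \<in> ideal_clone X I"
    using is_ideal_subset[OF I]
    by (auto simp: ideal_clone_def all_ops_def nary_ops_def projection_def nlistsE_nth_in)
next
  fix m f k gs
  assume *: "(m, f) \<in> ideal_clone X I \<and> 1 \<le> k \<and> length gs = m
    \<and> (\<forall>g\<in>set gs. (k, g) \<in> ideal_clone X I)"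
  have gs_in: "map (\<lambda>g. g xs) gs \<in> nlists m (\<Union>g\<in>set gs. g ` nlists k A)"
    if "xs \<in> nlists k A" for xs A
    using * that by (auto intro!: nlistsI bexI)
  have "(\<Union>g\<in>set gs. g ` nlists k X) \<subseteq> X"
    using * by (auto simp: ideal_clone_def all_ops_def nary_ops_def)
  then have "map (\<lambda>g. g xs) gs \<in> nlists m X" if "xs \<in> nlists k X" for xs
    using gs_in[OF that] nlists_mono by blast
  then have op: "(k, compose_ops X k f gs) \<in> all_ops X"
    using * by (auto simp: ideal_clone_def all_ops_def nary_ops_def compose_ops_def)
  have "compose_ops X k f gs ` nlists k A \<in> I" if "A \<in> I" for A
  proof -
    have "nlists k A \<subseteq> nlists k X"
      using is_ideal_carrier[OF I that] by (rule nlists_mono)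
    then have "compose_ops X k f gs ` nlists k A
        \<subseteq> f ` nlists m (\<Union>g\<in>set gs. g ` nlists k A)"
      using gs_in by (auto simp: compose_ops_def)
    moreover have "(\<Union>g\<in>set gs. g ` nlists k A) \<in> I"
      by (rule is_ideal_UNION[OF I]) (use * that in \<open>auto simp: ideal_clone_def\<close>)
    then have "f ` nlists m (\<Union>g\<in>set gs. g ` nlists k A) \<in> I"
      using * by (auto simp: ideal_clone_def)
    ultimately show ?thesis using is_ideal_subset[OF I] by blast
  qed
  with op show "(k, compose_ops X k f gs) \<in> ideal_clone X I"
    by (auto simp: ideal_clone_def)
qed

text \<open>
  An infinite small set can be mapped onto the whole countable set, which is not small.
\<close>

lemma ideal_clone_neq_all_ops:
  assumes X: "countable X" and I: "is_ideal X I"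
  shows "ideal_clone X I \<noteq> all_ops X"
proof -
  obtain B where B: "B \<in> I" "infinite B"
    using I by (auto simp: is_ideal_def)
  have "B \<subseteq> X" using B(1) by (rule is_ideal_carrier[OF I])
  have "X \<notin> I"
  proof
    assume "X \<in> I"
    then have "Pow X \<subseteq> I" using is_ideal_subset[OF I] by auto
    then show False using I by (auto simp: is_ideal_def)
  qed
  have "X \<noteq> {}" using B \<open>B \<subseteq> X\<close> by auto
  obtain e where e: "bij_betw e B (UNIV :: nat set)"
    using countableE_infinite countable_subset[OF \<open>B \<subseteq> X\<close> X] B(2) by blast
  define u where "u = (\<lambda>xs\<in>nlists 1 X. from_nat_into X (e (hd xs)))"
  have "(1, u) \<in> all_ops X"
    using from_nat_into[OF \<open>X \<noteq> {}\<close>] by (auto simp: all_ops_def nary_ops_def u_def)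
  moreover have "X \<subseteq> u ` nlists 1 B"
  proof
    fix x assume "x \<in> X"
    have "to_nat_on X x \<in> e ` B"
      using e by (simp add: bij_betw_def)
    then obtain b where b: "b \<in> B" "e b = to_nat_on X x"
      by auto
    have b_in: "[b] \<in> nlists 1 B" "[b] \<in> nlists 1 X"
      using b(1) \<open>B \<subseteq> X\<close> by (auto intro!: nlistsI)
    then have "u [b] = from_nat_into X (to_nat_on X x)"
      by (simp add: u_def b(2))
    also have "\<dots> = x"
      using X \<open>x \<in> X\<close> by (rule from_nat_into_to_nat_on)
    finally have "u [b] = x" .
    with b_in(1) show "x \<in> u ` nlists 1 B" by (metis image_eqI)
  qed
  then have "(1, u) \<notin> ideal_clone X I"
    using \<open>X \<notin> I\<close> B(1) is_ideal_subset[OF I] by (auto simp: ideal_clone_def)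
  ultimately show ?thesis by metis
qed

lemma T_prop_1:
  "T_prop X I A n 1 \<longleftrightarrow>
    (\<exists>f\<in>nary_ops X n. f ` nlists n A = X \<and> (\<forall>B\<in>I. f ` nlists n B \<in> I))"
proof -
  have [simp]: "{k. Suc 0 \<le> k \<and> enat k \<le> 1} = {Suc 0}"
    by (auto simp: one_enat_def)
  have *: "(\<exists>f :: nat \<Rightarrow> 'a list \<Rightarrow> 'a. P (f (Suc 0))) \<longleftrightarrow> (\<exists>f. P f)" for P
    by auto
  show ?thesis
    unfolding T_prop_def Bex_def
    using *[of "\<lambda>f. f \<in> nary_ops X n \<and> f ` nlists n A = X \<and> (\<forall>B\<in>I. f ` nlists n B \<in> I)"]
    by (simp del: Collect_conj_eq mem_Collect_eq)
qed

text \<open>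
  Let \<open>g\<close> be an operation outside the clone, mapping a small set \<open>B\<close> to a large set, and \<open>f\<close> a
  surjection for that large set. Every element is then a value of \<open>f\<close> composed with \<open>g\<close> at
  some matrix \<open>b\<close> of entries in \<open>B\<close>. For an operation \<open>h\<close>, the matrix
  entries that represent \<open>h xs\<close> are, as functions \<open>u j i\<close> of \<open>xs\<close>, operations with values in \<open>B\<close>;
  they lie in the clone, and \<open>h\<close> is composed from them by \<open>g\<close> and \<open>f\<close>.
\<close>

lemma precomplete_ideal_clone:
  assumes X: "countable X" and I: "is_ideal X I"
    and via: "precomplete_via X I 1 m" and m: "m \<ge> 1"
  shows "precomplete X (ideal_clone X I)"
proof -
  have "all_ops X \<subseteq> D" if D: "is_clone X D" "ideal_clone X I \<subset> D" for D
  proof -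
    obtain l g where g: "(l, g) \<in> D" "(l, g) \<notin> ideal_clone X I"
      using D(2) by auto
    then have "(l, g) \<in> all_ops X"
      using D(1) by (auto simp: is_clone_def)
    with g(2) obtain B where B: "B \<in> I" "g ` nlists l B \<notin> I"
      by (auto simp: ideal_clone_def)
    have "B \<subseteq> X" using B(1) by (rule is_ideal_carrier[OF I])
    then have "g ` nlists l B \<subseteq> X"
      using \<open>(l, g) \<in> all_ops X\<close> nlists_mono[OF \<open>B \<subseteq> X\<close>, of l]
      by (auto simp: all_ops_def nary_ops_def)
    with B(2) via obtain f where f: "f \<in> nary_ops X m"
      "f ` nlists m (g ` nlists l B) = X" "\<forall>C\<in>I. f ` nlists m C \<in> I"
      by (auto simp: precomplete_via_def T_prop_1)
    then have "(m, f) \<in> D"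
      using D(2) m by (auto simp: ideal_clone_def all_ops_def)
    have "\<exists>b. (\<forall>j<m. b j \<in> nlists l B) \<and> f (map (\<lambda>j. g (b j)) [0..<m]) = x"
      if "x \<in> X" for x
    proof -
      have "x \<in> f ` nlists m (g ` nlists l B)"
        using that by (simp add: f(2))
      then obtain ys where ys: "ys \<in> nlists m (g ` nlists l B)" "f ys = x"
        by blast
      have "\<forall>j<m. \<exists>bs. bs \<in> nlists l B \<and> g bs = ys ! j"
        using nlistsE_nth_in[OF ys(1)] by fastforce
      then obtain b where b: "\<forall>j<m. b j \<in> nlists l B \<and> g (b j) = ys ! j"
        by metis
      then have "map (\<lambda>j. g (b j)) [0..<m] = ys"
        using ys(1) by (intro nth_equalityI) auto
      with b ys(2) show ?thesis by auto
    qed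
    then obtain b where b: "\<And>x j. x \<in> X \<Longrightarrow> j < m \<Longrightarrow> b x j \<in> nlists l B"
      "\<And>x. x \<in> X \<Longrightarrow> f (map (\<lambda>j. g (b x j)) [0..<m]) = x"
      by metis
    show "all_ops X \<subseteq> D"
    proof clarify
      fix k h assume kh: "(k, h) \<in> all_ops X"
      then have "k \<ge> 1" and hX: "\<And>xs. xs \<in> nlists k X \<Longrightarrow> h xs \<in> X"
        by (auto simp: all_ops_def nary_ops_def)
      define u where "u j i = (\<lambda>xs\<in>nlists k X. b (h xs) j ! i)" for j i
      have u_B: "u j i xs \<in> B" if "j < m" "i < l" "xs \<in> nlists k X" for j i xs
        using b(1)[OF hX[OF that(3)] that(1)] that nlistsE_nth_in by (auto simp: u_def)
      have u: "(k, u j i) \<in> D" if "j < m" "i < l" for j i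
      proof -
        have "(k, u j i) \<in> all_ops X"
          using u_B[OF that] \<open>B \<subseteq> X\<close> \<open>k \<ge> 1\<close>
          by (auto simp: all_ops_def nary_ops_def) (auto simp: u_def)
        moreover have "u j i ` nlists k A \<in> I" if "A \<in> I" for A
        proof -
          have "nlists k A \<subseteq> nlists k X"
            using is_ideal_carrier[OF I that] by (rule nlists_mono)
          then have "u j i ` nlists k A \<subseteq> B"
            using u_B[OF \<open>j < m\<close> \<open>i < l\<close>] by auto
          then show ?thesis using is_ideal_subset[OF I B(1)] by blast
        qed
        ultimately show ?thesis
          using D(2) by (auto simp: ideal_clone_def)
      qed
      define G where "G j = compose_ops X k g (map (u j) [0..<l])" for j
      have G: "(k, G j) \<in> D" if "j < m" for j
      proof -
        have "\<forall>v\<in>set (map (u j) [0..<l]). (k, v) \<in> D"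
          using u[OF that] by auto
        then show ?thesis
          using D(1) g(1) \<open>k \<ge> 1\<close> unfolding is_clone_def G_def by simp
      qed
      have G_eq: "G j xs = g (b (h xs) j)" if "j < m" "xs \<in> nlists k X" for j xs
      proof -
        have "length (b (h xs) j) = l"
          using b(1)[OF hX[OF that(2)] that(1)] by simp
        then have "map (\<lambda>i. b (h xs) j ! i) [0..<l] = b (h xs) j"
          by (metis map_nth)
        then show ?thesis
          using that(2) by (simp add: G_def compose_ops_def u_def comp_def)
      qed
      have "compose_ops X k f (map G [0..<m]) = h"
      proof
        fix xs
        show "compose_ops X k f (map G [0..<m]) xs = h xs"
        proof (cases "xs \<in> nlists k X")
          case True
          have "map (\<lambda>j. G j xs) [0..<m] = map (\<lambda>j. g (b (h xs) j)) [0..<m]"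
            using G_eq[OF _ True] by (intro map_cong) auto
          with True have "compose_ops X k f (map G [0..<m]) xs
              = f (map (\<lambda>j. g (b (h xs) j)) [0..<m])"
            unfolding compose_ops_def by (simp only: map_map comp_def restrict_apply if_True)
          then show ?thesis
            using b(2)[OF hX[OF True]] by simp
        next
          case False
          then show ?thesis
            using kh by (auto simp: compose_ops_def all_ops_def nary_ops_def)
        qed
      qed
      moreover have "\<forall>v\<in>set (map G [0..<m]). (k, v) \<in> D"
        using G by auto
      then have "(k, compose_ops X k f (map G [0..<m])) \<in> D"
        using D(1) \<open>(m, f) \<in> D\<close> \<open>k \<ge> 1\<close> unfolding is_clone_def by simp
      ultimately show "(k, h) \<in> D" by simp
    qed
  qed
  then show ?thesis
    using is_clone_ideal_clone[OF I] ideal_clone_neq_all_ops[OF X I]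
    unfolding precomplete_def by blast
qed

section \<open>Maximal ideals on the natural numbers\<close>

text \<open>
  These are the families of complements of the sets in a nonprincipal ultrafilter.
\<close>

locale free_maximal_ideal =
  fixes J :: "nat set set"
  assumes subset: "A \<in> J \<Longrightarrow> B \<subseteq> A \<Longrightarrow> B \<in> J"
    and Un: "A \<in> J \<Longrightarrow> B \<in> J \<Longrightarrow> A \<union> B \<in> J"
    and finite: "finite A \<Longrightarrow> A \<in> J"
    and proper: "UNIV \<notin> J"
    and maximal: "A \<in> J \<or> - A \<in> J"

lemma ex_free_maximal_ideal: "\<exists>J. free_maximal_ideal J"
proof -
  define \<F> :: "nat set set set" where "\<F> = {J. (\<forall>A\<in>J. \<forall>B\<subseteq>A. B \<in> J) \<and>
    (\<forall>A\<in>J. \<forall>B\<in>J. A \<union> B \<in> J) \<and> (\<forall>A. finite A \<longrightarrow> A \<in> J) \<and> UNIV \<notin> J}"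
  have "\<exists>M\<in>\<F>. \<forall>K\<in>\<F>. M \<subseteq> K \<longrightarrow> K = M"
  proof (rule subset_Zorn_nonempty)
    have "{A. finite A} \<in> \<F>"
      by (auto simp: \<F>_def intro: finite_subset)
    then show "\<F> \<noteq> {}" by blast
  next
    fix \<C> assume ne: "\<C> \<noteq> {}" and "subset.chain \<F> \<C>"
    then have sub: "\<C> \<subseteq> \<F>" and ch: "\<And>K L. K \<in> \<C> \<Longrightarrow> L \<in> \<C> \<Longrightarrow> K \<subseteq> L \<or> L \<subseteq> K"
      by (auto simp: subset_chain_def)
    have un: "A \<union> B \<in> K" if "A \<in> K" "B \<in> K" "K \<in> \<C>" for A B K
      using that subsetD[OF sub \<open>K \<in> \<C>\<close>] by (simp add: \<F>_def)
    have "A \<union> B \<in> \<Union>\<C>" if "A \<in> K" "K \<in> \<C>" "B \<in> L" "L \<in> \<C>" for A B K L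
      using ch[OF that(2,4)] that un by blast
    then have "\<forall>A\<in>\<Union>\<C>. \<forall>B\<in>\<Union>\<C>. A \<union> B \<in> \<Union>\<C>"
      by (meson UnionE)
    moreover have "B \<in> \<Union>\<C>" if "A \<in> \<Union>\<C>" "B \<subseteq> A" for A B
    proof -
      from that(1) obtain K where "A \<in> K" "K \<in> \<C>" by (rule UnionE)
      with subsetD[OF sub \<open>K \<in> \<C>\<close>] that(2) have "B \<in> K" by (simp add: \<F>_def)
      with \<open>K \<in> \<C>\<close> show ?thesis by (rule UnionI)
    qed
    moreover have "A \<in> \<Union>\<C>" if "finite A" for A
      using that ne sub by (auto simp: \<F>_def)
    moreover have "UNIV \<notin> \<Union>\<C>"
      using sub by (auto simp: \<F>_def)
    ultimately show "\<Union>\<C> \<in> \<F>"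
      unfolding \<F>_def by blast
  qed
  then obtain M where M: "M \<in> \<F>" and max: "\<And>K. K \<in> \<F> \<Longrightarrow> M \<subseteq> K \<Longrightarrow> K = M"
    by blast
  have sub: "B \<in> M" if "A \<in> M" "B \<subseteq> A" for A B
    using M that by (auto simp: \<F>_def)
  have un: "A \<union> B \<in> M" if "A \<in> M" "B \<in> M" for A B
    using M that by (auto simp: \<F>_def)
  have fin: "A \<in> M" if "finite A" for A
    using M that by (auto simp: \<F>_def)
  have "A \<in> M \<or> - A \<in> M" for A
  proof (rule ccontr)
    assume A: "\<not> (A \<in> M \<or> - A \<in> M)"
    \<comment> \<open>the ideal generated by \<open>M\<close> and \<open>A\<close>\<close>
    define K where "K = {C. C - A \<in> M}"
    have "K \<in> \<F>"
      unfolding \<F>_def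
    proof (intro CollectI conjI ballI allI impI)
      show "C' \<in> K" if "C \<in> K" "C' \<subseteq> C" for C C'
        using that sub[of "C - A" "C' - A"] by (auto simp: K_def)
      show "C \<union> C' \<in> K" if "C \<in> K" "C' \<in> K" for C C'
        using that un[of "C - A" "C' - A"] by (auto simp: K_def Un_Diff)
      show "C \<in> K" if "finite C" for C
        using that fin by (auto simp: K_def)
      show "UNIV \<notin> K"
        using A by (auto simp: K_def Compl_eq_Diff_UNIV)
    qed
    moreover have "M \<subseteq> K"
      using sub by (auto simp: K_def)
    ultimately have "K = M" by (rule max)
    moreover have "A \<in> K"
      using fin by (auto simp: K_def)
    ultimately show False using A by simp
  qed
  then have "free_maximal_ideal M"
    using M by unfold_locales (auto simp: \<F>_def)
  then show ?thesis ..
qed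

context free_maximal_ideal
begin

lemma UNION: "finite K \<Longrightarrow> (\<And>k. k \<in> K \<Longrightarrow> A k \<in> J) \<Longrightarrow> (\<Union>k\<in>K. A k) \<in> J"
  by (induction K rule: finite_induct) (auto intro: finite Un)

lemma ex_infinite_subset:
  assumes "infinite A"
  obtains D where "D \<subseteq> A" "infinite D" "D \<in> J"
proof -
  obtain C :: "nat \<Rightarrow> nat set" where C: "pairwise (\<lambda>i j. disjnt (C i) (C j)) UNIV"
    "(\<Union>i. C i) \<subseteq> A" "\<And>i. infinite (C i)"
    using infinite_infinite_partition[OF assms] by blast
  have "disjnt (C 0) (C 1)"
    using C(1) by (simp add: pairwise_def)
  then have "C 1 \<subseteq> - C 0" by (auto simp: disjnt_def)
  then have "C 0 \<in> J \<or> C 1 \<in> J"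
    using maximal[of "C 0"] subset by blast
  then show ?thesis using C that by blast
qed

text \<open>
  It is enough to move an infinite small part \<open>D\<close> of \<open>A\<close>, namely onto the union of \<open>D\<close> and the
  complement of \<open>A\<close>. As \<open>A\<close> is large, this union is small, and images grow by at most
  this small set.
\<close>

lemma unary_onto:
  assumes "A \<notin> J"
  obtains h where "h ` A = UNIV" "\<And>B. B \<in> J \<Longrightarrow> h ` B \<in> J"
proof -
  have "- A \<in> J" using assms maximal by blast
  have "infinite A" using assms finite by blast
  then obtain D where D: "D \<subseteq> A" "infinite D" "D \<in> J"
    by (rule ex_infinite_subset)
  obtain e where e: "bij_betw e D (UNIV :: nat set)"
    using countableE_infinite[of D] D(2) by auto
  define h where "h x = (if x \<in> D then from_nat_into (D \<union> - A) (e x) else x)" for x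
  have "D \<union> - A \<noteq> {}" using D(2) by auto
  have "h ` D = from_nat_into (D \<union> - A) ` (e ` D)"
    by (auto simp: h_def)
  also have "\<dots> = D \<union> - A"
    using e range_from_nat_into[OF \<open>D \<union> - A \<noteq> {}\<close>] by (simp add: bij_betw_def)
  finally have hD: "h ` D = D \<union> - A" .
  moreover have "h ` (A - D) = A - D"
    by (auto simp: h_def)
  moreover have "A = D \<union> (A - D)"
    using D(1) by blast
  then have "h ` A = h ` D \<union> h ` (A - D)"
    by (metis image_Un)
  ultimately have "h ` A = UNIV"
    by auto
  moreover have "h ` B \<in> J" if "B \<in> J" for B
  proof -
    have "h x \<in> B \<union> (D \<union> - A)" if "x \<in> B" for x
    proof (cases "x \<in> D")
      case True
      then have "h x \<in> h ` D" by (rule imageI)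
      then show ?thesis by (simp add: hD)
    next
      case False
      then show ?thesis using that by (simp add: h_def)
    qed
    then have "h ` B \<subseteq> B \<union> (D \<union> - A)" by blast
    then show ?thesis
      using subset Un that D(3) \<open>- A \<in> J\<close> by meson
  qed
  ultimately show ?thesis by (rule that)
qed

end

section \<open>Functions without fixed points\<close>

text \<open>
  Going down along \<open>f\<close> ends after finitely many steps; the colour is the parity of their number.
\<close>

fun descent_colour :: "(nat \<Rightarrow> nat) \<Rightarrow> nat \<Rightarrow> bool" where
  "descent_colour f z = (if f z < z then \<not> descent_colour f (f z) else True)"

declare descent_colour.simps [simp del]

text \<open>
  In each orbit, that is, each class of numbers whose forward iterates
  eventually meet, the colour is the parity of the signed distance to a fixed representative;
  it is well defined because an increasing function has no cycles.
\<close>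

lemma ascent_colour:
  fixes f :: "nat \<Rightarrow> nat"
  assumes f: "\<And>z. f z > z"
  shows "\<exists>c :: nat \<Rightarrow> bool. \<forall>z. c (f z) \<noteq> c z"
proof -
  have "strict_mono (\<lambda>a. (f ^^ a) z)" for z
    unfolding strict_mono_Suc_iff by (simp add: f)
  then have acyclic: "a = b" if "(f ^^ a) z = (f ^^ b) z" for a b z
    using that by (auto dest: strict_mono_eq)
  define meet where "meet x y \<longleftrightarrow> (\<exists>a b. (f ^^ a) x = (f ^^ b) y)" for x y
  have shift: "(f ^^ a) (f x) = (f ^^ Suc b) y" if "(f ^^ a) x = (f ^^ b) y" for a b x y
    using that by (metis comp_apply funpow.simps(2) funpow_swap1)
  have "meet (f x) y \<longleftrightarrow> meet x y" for x y
    unfolding meet_def using shift by (metis comp_apply funpow_Suc_right)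
  define rep where "rep x = (LEAST y. meet x y)" for x
  have rep_f: "rep (f x) = rep x" for x
    by (simp add: rep_def \<open>\<And>x y. meet (f x) y \<longleftrightarrow> meet x y\<close>)
  have "meet x x" for x
    by (auto simp: meet_def)
  then have rep: "meet x (rep x)" for x
    unfolding rep_def by (rule LeastI)
  define c where "c x \<longleftrightarrow> (\<exists>a b. (f ^^ a) x = (f ^^ b) (rep x) \<and> even (a + b))" for x
  have "c (f z) \<noteq> c z" for z
  proof (cases "c z")
    case True
    then obtain a b where ab: "(f ^^ a) z = (f ^^ b) (rep z)" "even (a + b)"
      by (auto simp: c_def)
    have "\<not> c (f z)"
    proof
      assume "c (f z)"
      then obtain a' b' where ab': "(f ^^ a') (f z) = (f ^^ b') (rep z)" "even (a' + b')"
        by (auto simp: c_def rep_f)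
      have "(f ^^ (b + Suc a')) z = (f ^^ b) ((f ^^ a') (f z))"
        by (simp add: funpow_add funpow_swap1)
      also have "\<dots> = (f ^^ (b + b')) (rep z)"
        by (simp only: funpow_add comp_apply ab'(1))
      also have "\<dots> = (f ^^ (b' + b)) (rep z)"
        by (simp only: add.commute)
      also have "\<dots> = (f ^^ (b' + a)) z"
        by (simp only: funpow_add comp_apply ab(1))
      finally have "b + Suc a' = b' + a" by (rule acyclic)
      then have "even (b + Suc a' + (b' + a))" by simp
      with ab(2) ab'(2) show False by (auto simp: even_add)
    qed
    with True show ?thesis by simp
  next
    case False
    obtain a b where ab: "(f ^^ a) z = (f ^^ b) (rep z)"
      using rep[of z] by (auto simp: meet_def)
    have "odd (a + b)" using False ab by (auto simp: c_def)
    then have "even (a + Suc b)" by simp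
    with shift[OF ab] have "c (f z)"
      unfolding c_def rep_f by blast
    with False show ?thesis by simp
  qed
  then show ?thesis by (intro exI[of _ c] allI)
qed

context free_maximal_ideal
begin

text \<open>One of the two colour classes is small; the large class is mapped into it.\<close>

lemma moves_off_coloured:
  fixes c :: "nat \<Rightarrow> bool"
  assumes "\<And>z. z \<in> U \<Longrightarrow> c (f z) \<noteq> c z"
  obtains V where "V \<subseteq> U" "U - V \<in> J" "f ` V \<in> J"
proof -
  have *: "\<exists>V\<subseteq>U. U - V \<in> J \<and> f ` V \<in> J" if "{z. P z} \<in> J" "\<And>z. z \<in> U \<Longrightarrow> P (f z) \<noteq> P z" for P
  proof (intro exI conjI)
    show "U - (U - {z. P z}) \<in> J" "f ` (U - {z. P z}) \<in> J"
      using that by (auto intro: subset)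
  qed auto
  have "{z. c z} \<in> J \<or> {z. \<not> c z} \<in> J"
    using maximal[of "{z. c z}"] by (simp add: Collect_neg_eq)
  then show ?thesis
    using *[of c] *[of "\<lambda>z. \<not> c z"] assms that by blast
qed

lemma moves_off:
  assumes f: "\<And>z. z \<in> U \<Longrightarrow> f z \<noteq> z"
  obtains V where "V \<subseteq> U" "U - V \<in> J" "f ` V \<in> J"
proof -
  define U1 where "U1 = {z \<in> U. f z < z}"
  define U2 where "U2 = {z \<in> U. f z > z}"
  have U: "U = U1 \<union> U2"
    using f by (auto simp: U1_def U2_def neq_iff)
  have "descent_colour f (f z) \<noteq> descent_colour f z" if "z \<in> U1" for z
    using that by (subst (2) descent_colour.simps) (simp add: U1_def)
  then obtain V1 where V1: "V1 \<subseteq> U1" "U1 - V1 \<in> J" "f ` V1 \<in> J"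
    by (rule moves_off_coloured[of U1 "descent_colour f" f])
  \<comment> \<open>agrees with \<open>f\<close> on \<open>U2\<close> and is increasing everywhere\<close>
  define f' where "f' z = max (f z) (Suc z)" for z
  have "\<exists>c :: nat \<Rightarrow> bool. \<forall>z. c (f' z) \<noteq> c z"
    by (rule ascent_colour) (simp add: f'_def)
  then obtain c :: "nat \<Rightarrow> bool" where c: "\<forall>z. c (f' z) \<noteq> c z" ..
  have "c (f z) \<noteq> c z" if "z \<in> U2" for z
  proof -
    have "f' z = f z" using that by (simp add: U2_def f'_def)
    then show ?thesis using c[rule_format, of z] by simp
  qed
  then obtain V2 where V2: "V2 \<subseteq> U2" "U2 - V2 \<in> J" "f ` V2 \<in> J"
    by (rule moves_off_coloured[of U2 c f])
  have "U - (V1 \<union> V2) \<in> J"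
    by (rule subset[OF Un[OF V1(2) V2(2)]]) (auto simp: U)
  moreover have "f ` (V1 \<union> V2) \<in> J"
    using Un[OF V1(3) V2(3)] by (simp add: image_Un)
  ultimately show ?thesis
    using that[of "V1 \<union> V2"] V1(1) V2(1) U by blast
qed

text \<open>
  For each output \<open>z\<close> that occurs off its inputs choose such an input list. None of its \<open>n\<close> entries is
  \<open>z\<close>, so, after removing a small set of \<open>z\<close>, all entries come from a
  small set \<open>B\<close>. The remaining \<open>z\<close> are outputs on lists over \<open>B\<close>, hence few.
\<close>

lemma few_outputs_off_inputs:
  assumes S: "\<And>B. B \<in> J \<Longrightarrow> (\<Union>ys\<in>nlists n B. S ys) \<in> J"
  shows "{z. \<exists>ys\<in>nlists n UNIV. z \<in> S ys \<and> z \<notin> set ys} \<in> J" (is "?U \<in> J")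
proof -
  have "\<forall>z\<in>?U. \<exists>ys. ys \<in> nlists n UNIV \<and> z \<in> S ys \<and> z \<notin> set ys"
    by auto
  then have "\<exists>r. \<forall>z\<in>?U. r z \<in> nlists n UNIV \<and> z \<in> S (r z) \<and> z \<notin> set (r z)"
    by (rule bchoice)
  then obtain r where
    r: "\<And>z. z \<in> ?U \<Longrightarrow> r z \<in> nlists n UNIV \<and> z \<in> S (r z) \<and> z \<notin> set (r z)"
    by (elim exE) blast
  have "\<exists>V. V \<subseteq> ?U \<and> ?U - V \<in> J \<and> (\<lambda>z. r z ! i) ` V \<in> J" if "i \<in> {..<n}" for i
  proof -
    have "r z ! i \<noteq> z" if "z \<in> ?U" for z
      using r[OF that] \<open>i \<in> {..<n}\<close> by (metis in_nlists_UNIV lessThan_iff nth_mem)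
    then obtain V where "V \<subseteq> ?U" "?U - V \<in> J" "(\<lambda>z. r z ! i) ` V \<in> J"
      by (rule moves_off[of ?U "\<lambda>z. r z ! i"])
    then show ?thesis by blast
  qed
  then have "\<exists>V. \<forall>i\<in>{..<n}. V i \<subseteq> ?U \<and> ?U - V i \<in> J \<and> (\<lambda>z. r z ! i) ` V i \<in> J"
    by (intro bchoice ballI)
  then obtain V where
    V: "\<forall>i\<in>{..<n}. V i \<subseteq> ?U \<and> ?U - V i \<in> J \<and> (\<lambda>z. r z ! i) ` V i \<in> J" ..
  define W where "W = ?U \<inter> {z. \<forall>i<n. z \<in> V i}"
  define B where "B = (\<Union>i<n. (\<lambda>z. r z ! i) ` V i)"
  have "B \<in> J"
    unfolding B_def using V by (intro UNION) auto
  have "r z \<in> nlists n B \<and> z \<in> S (r z)" if "z \<in> W" for z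
  proof -
    have "z \<in> ?U" using that unfolding W_def by (rule IntD1)
    then have "length (r z) = n" using r[of z] by (metis in_nlists_UNIV)
    moreover have "r z ! i \<in> B" if "i < n" for i
      using \<open>z \<in> W\<close> that by (auto simp: W_def B_def)
    ultimately have "r z \<in> nlists n B"
      by (auto intro!: nlistsI simp: in_set_conv_nth)
    with r[OF \<open>z \<in> ?U\<close>] show ?thesis by simp
  qed
  then have "W \<subseteq> (\<Union>ys\<in>nlists n B. S ys)"
    by blast
  then have "W \<in> J" using S[OF \<open>B \<in> J\<close>] subset by blast
  moreover have "(\<Union>i<n. ?U - V i) \<in> J"
    using V by (intro UNION) auto
  moreover have "?U \<subseteq> W \<union> (\<Union>i<n. ?U - V i)"
    by (auto simp: W_def)
  ultimately show ?thesis using Un subset by meson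
qed

end

section \<open>The ideal of sets with small projections\<close>

text \<open>
  A number \<open>x\<close> stands for the tuple \<open>d x\<close>, so that the ideal of tuples lives on the natural numbers.
\<close>

locale coded_tuples = free_maximal_ideal J for J +
  fixes n :: nat and d :: "nat \<Rightarrow> nat list"
  assumes d: "bij_betw d UNIV (nlists (Suc n) UNIV)"
begin

definition proj :: "nat \<Rightarrow> nat \<Rightarrow> nat" where
  "proj i x = d x ! i"

definition encode :: "nat list \<Rightarrow> nat" where
  "encode = inv_into UNIV d"

definition cube_ideal :: "nat set set" where
  "cube_ideal = {B. \<forall>i\<le>n. proj i ` B \<in> J}"

definition diag :: "nat \<Rightarrow> nat" where
  "diag y = encode (replicate (Suc n) y)"

lemma d_encode: "length zs = Suc n \<Longrightarrow> d (encode zs) = zs"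
  using d unfolding encode_def
  by (metis bij_betw_imp_surj_on f_inv_into_f in_nlists_UNIV)

lemma encode_d: "encode (d x) = x"
  using d unfolding encode_def by (simp add: bij_betw_def)

lemma length_d: "length (d x) = Suc n"
  using d by (metis UNIV_I bij_betwE in_nlists_UNIV)

lemma proj_diag: "i \<le> n \<Longrightarrow> proj i (diag y) = y"
  by (simp add: proj_def diag_def d_encode del: replicate_Suc)

lemma proj_encode_map:
  "i \<le> n \<Longrightarrow> length xs = Suc n \<Longrightarrow> proj i (encode (map h xs)) = h (xs ! i)"
  by (simp add: proj_def d_encode)

lemma diag_in_cube_ideal: "diag ` D \<in> cube_ideal \<longleftrightarrow> D \<in> J"
  by (auto simp: cube_ideal_def image_image proj_diag)

lemma is_ideal_cube_ideal: "is_ideal UNIV cube_ideal"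
  unfolding is_ideal_def
proof (intro conjI ballI allI impI)
  show "B \<in> cube_ideal" if "A \<in> cube_ideal" "B \<subseteq> A" for A B
    using that by (auto simp: cube_ideal_def intro: subset image_mono)
  show "A \<union> B \<in> cube_ideal" if "A \<in> cube_ideal" "B \<in> cube_ideal" for A B
    using that by (auto simp: cube_ideal_def image_Un intro: Un)
  show "A \<in> cube_ideal" if "A \<subseteq> UNIV \<and> finite A" for A
    using that by (auto simp: cube_ideal_def intro: finite)
  obtain D where "infinite D" "D \<in> J"
    using ex_infinite_subset[OF infinite_UNIV_nat] by blast
  moreover have "inj diag"
    using proj_diag[of 0] by (metis injI le0)
  ultimately show "\<exists>A\<in>cube_ideal. infinite A"
    using diag_in_cube_ideal by (metis finite_imageD inj_on_subset subset_UNIV)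
  have "diag ` UNIV \<notin> cube_ideal"
    using proper diag_in_cube_ideal by blast
  then show "cube_ideal \<noteq> Pow UNIV" by blast
qed auto

text \<open>
  A large set has a projection that is large for \<open>J\<close>, and each of its \<open>n+1\<close> arguments
  lets the function fill one coordinate of the value, using the surjection of that projection onto
  all numbers.
\<close>

lemma precomplete_via_Suc: "precomplete_via UNIV cube_ideal 1 (Suc n)"
  unfolding precomplete_via_def T_prop_1
proof (intro allI impI)
  fix A assume "A \<subseteq> UNIV \<and> A \<notin> cube_ideal"
  then obtain i where "i \<le> n" "proj i ` A \<notin> J"
    by (auto simp: cube_ideal_def)
  then obtain h where h: "h ` proj i ` A = UNIV" "\<And>B. B \<in> J \<Longrightarrow> h ` B \<in> J"
    by (metis unary_onto)
  define f where "f = (\<lambda>xs\<in>nlists (Suc n) UNIV. encode (map (h \<circ> proj i) xs))"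
  have "x \<in> f ` nlists (Suc n) A" for x
  proof -
    have "\<forall>z. \<exists>a\<in>A. h (proj i a) = z"
      using h(1) by (metis UNIV_I imageE)
    then obtain a where a: "\<And>z. a z \<in> A" "\<And>z. h (proj i (a z)) = z"
      by metis
    have "map a (d x) \<in> nlists (Suc n) A"
      using a(1) length_d by (auto intro!: nlistsI)
    moreover have "f (map a (d x)) = x"
      by (simp add: f_def in_nlists_UNIV length_d comp_def a(2) encode_d)
    ultimately show ?thesis by (metis image_eqI)
  qed
  moreover have "f ` nlists (Suc n) B \<in> cube_ideal" if "B \<in> cube_ideal" for B
  proof -
    have "proj j ` f ` nlists (Suc n) B \<subseteq> h ` proj i ` B" if "j \<le> n" for j
    proof clarify
      fix xs assume xs: "xs \<in> nlists (Suc n) B"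
      then have "proj j (f xs) = h (proj i (xs ! j))"
        using that by (simp add: f_def in_nlists_UNIV proj_encode_map)
      moreover have "xs ! j \<in> B"
        using xs that by (intro nlistsE_nth_in) auto
      ultimately show "proj j (f xs) \<in> h ` proj i ` B" by auto
    qed
    moreover have "h ` proj i ` B \<in> J"
      using h(2) that \<open>i \<le> n\<close> by (auto simp: cube_ideal_def)
    ultimately show ?thesis
      using subset by (auto simp: cube_ideal_def)
  qed
  ultimately show "\<exists>f\<in>nary_ops UNIV (Suc n). f ` nlists (Suc n) A = UNIV
      \<and> (\<forall>B\<in>cube_ideal. f ` nlists (Suc n) B \<in> cube_ideal)"
    by (intro bexI[of _ f]) (auto simp: nary_ops_def f_def)
qed

text \<open>
  On the diagonal, a value with \<open>n+1\<close> distinct coordinates would have to be produced from \<open>n\<close>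
  numbers, although apart from a small set of exceptions coordinates occur only among these numbers.
\<close>

lemma not_precomplete_via: "\<not> precomplete_via UNIV cube_ideal \<infinity> n"
proof
  assume "precomplete_via UNIV cube_ideal \<infinity> n"
  moreover have "range diag \<notin> cube_ideal"
    using proper by (simp add: diag_in_cube_ideal)
  ultimately have "T_prop UNIV cube_ideal (range diag) n \<infinity>"
    by (simp add: precomplete_via_def)
  then obtain f :: "nat \<Rightarrow> nat list \<Rightarrow> nat"
    where onto: "(\<Union>k\<in>{1..}. f k ` nlists n (range diag)) = UNIV"
      and pres: "\<And>B. B \<in> cube_ideal \<Longrightarrow> (\<Union>k\<in>{1..}. f k ` nlists n B) \<in> cube_ideal"
    unfolding T_prop_def atLeast_def by auto
  define S where "S ys = {proj i (f k (map diag ys)) | i k. i \<le> n \<and> 1 \<le> k}" for ys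
  have "(\<Union>ys\<in>nlists n B. S ys) \<in> J" if "B \<in> J" for B
  proof -
    define C where "C = (\<Union>k\<in>{1..}. f k ` nlists n (diag ` B))"
    have "C \<in> cube_ideal"
      unfolding C_def using that by (intro pres) (simp add: diag_in_cube_ideal)
    then have "(\<Union>i\<le>n. proj i ` C) \<in> J"
      by (intro UNION) (auto simp: cube_ideal_def)
    moreover have "map diag ys \<in> nlists n (diag ` B)" if "ys \<in> nlists n B" for ys
      using that subsetD[OF nlistsE_set[OF that]] by (intro nlistsI) auto
    then have "(\<Union>ys\<in>nlists n B. S ys) \<subseteq> (\<Union>i\<le>n. proj i ` C)"
      by (fastforce simp: S_def C_def)
    ultimately show ?thesis by (rule subset)
  qed
  then have E: "{z. \<exists>ys\<in>nlists n UNIV. z \<in> S ys \<and> z \<notin> set ys} \<in> J" (is "?E \<in> J")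
    by (rule few_outputs_off_inputs)
  then have "infinite (- ?E)"
    using proper Un[OF E finite[of "- ?E"]] by auto
  from infinite_arbitrarily_large[OF this, of "Suc n"]
  obtain T where T: "finite T" "card T = Suc n" "T \<subseteq> - ?E"
    by (elim exE conjE)
  obtain zs where "set zs = T" "distinct zs"
    using finite_distinct_list[OF T(1)] by (elim exE conjE)
  then have zs: "set zs = T" "length zs = Suc n"
    using T(2) distinct_card[of zs] by simp_all
  obtain k xs where k: "k \<ge> 1" and xs: "xs \<in> nlists n (range diag)"
    and eq: "f k xs = encode zs"
  proof -
    have "encode zs \<in> (\<Union>k\<in>{1..}. f k ` nlists n (range diag))"
      using onto by simp
    then show ?thesis using that by fastforce
  qed
  define ys where "ys = map (inv_into UNIV diag) xs"
  have ys: "length ys = n"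
    using xs by (simp add: ys_def)
  have "map diag ys = map id xs"
    unfolding ys_def map_map using nlistsE_set[OF xs]
    by (intro map_cong) (auto simp: f_inv_into_f subset_eq)
  then have "map diag ys = xs" by simp
  have "T \<subseteq> set ys"
  proof
    fix z assume "z \<in> T"
    then obtain i where "i \<le> n" "z = proj i (f k (map diag ys))"
      using zs eq \<open>map diag ys = xs\<close>
      by (metis proj_def d_encode in_set_conv_nth less_Suc_eq_le)
    then have "z \<in> S ys" using k by (auto simp: S_def)
    then show "z \<in> set ys"
      using subsetD[OF T(3) \<open>z \<in> T\<close>] ys by (auto simp: in_nlists_UNIV)
  qed
  then have "card T \<le> n"
    using ys by (metis List.finite_set card_length card_mono le_trans)
  then show False using T(2) by simp
qed

end

theorem mainTheorem9:
  fixes n :: nat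
  assumes "n \<ge> 1"
  shows "\<exists>(X :: nat set) I.
    countable X \<and> infinite X \<and> is_ideal X I \<and>
    precomplete X (ideal_clone X I) \<and>
    precomplete_via X I 1 (n + 1) \<and>
    \<not> precomplete_via X I \<infinity> n"
proof -
  obtain J where "free_maximal_ideal J"
    using ex_free_maximal_ideal by blast
  have "infinite (nlists (Suc n) (UNIV :: nat set))"
  proof -
    have "inj (replicate (Suc n) :: nat \<Rightarrow> nat list)"
      by (rule injI) simp
    then have "infinite (range (replicate (Suc n) :: nat \<Rightarrow> nat list))"
      by (rule range_inj_infinite)
    moreover have "range (replicate (Suc n)) \<subseteq> nlists (Suc n) (UNIV :: nat set)"
      by auto
    ultimately show ?thesis using infinite_super by blast
  qed
  then obtain d :: "nat \<Rightarrow> nat list" where "bij_betw d UNIV (nlists (Suc n) UNIV)"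
    using bij_betw_from_nat_into[OF countableI_type] by blast
  with \<open>free_maximal_ideal J\<close> interpret coded_tuples J n d
    by (simp add: coded_tuples_def coded_tuples_axioms_def)
  have "precomplete UNIV (ideal_clone UNIV cube_ideal)"
    by (rule precomplete_ideal_clone[OF _ is_ideal_cube_ideal precomplete_via_Suc]) auto
  then show ?thesis
    using is_ideal_cube_ideal precomplete_via_Suc not_precomplete_via
    by (intro exI[of _ UNIV] exI[of _ cube_ideal]) auto
qed

end
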